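(* Let $A$ and $B$ be integral domains, $J$ an ideal of $B$ and $f:A\to B$ a non-injective ring homomorphism. Then the following statements are equivalent: (1) $A\bowtie^f J$ is an Hermite ring. (2) $A\bowtie^f J$ is a Bézout ring. (3) One of the following conditions holds: - $J=B$, and $A$ and $B$ are Bézout rings; - $J=0$, and $A$ is a Bézout ring.
   Context: All rings are commutative with identity, and ring homomorphisms preserve the identity. For a ring homomorphism $f:A\to B$ and an ideal $J$ of $B$, the amalgamation of $A$ with $B$ along $J$ with respect to $f$ is the subring $A\bowtie^f J=\{(a,f(a)+j) : a\in A,\ j\in J\}$ of $A\times B$. A ring is a Bézout ring if every finitely generated ideal is principal (zero divisors are allowed). A ring $R$ is an Hermite ring if for every matrix $M$ over $R$ there exists a non-singular (i.e. invertible over $R$) square matrix $Q$ over $R$ such that $MQ$ is a triangular matrix; equivalently (a known characterization), for all $a,b\in R$ there exist $a_1,b_1,d\in R$ such that $a=a_1d$, $b=b_1d$ and $Ra_1+Rb_1=R$. *)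

theory Defs
  imports "Jordan_Normal_Form.Matrix" "HOL-Algebra.Chinese_Remainder" "HOL-Algebra.Subrings"
begin

definition amalg_set ::
    "('a, 'm) ring_scheme \<Rightarrow> ('b, 'n) ring_scheme \<Rightarrow> ('a \<Rightarrow> 'b) \<Rightarrow> 'b set \<Rightarrow> ('a \<times> 'b) set"
  where "amalg_set A B f J = {(a, f a \<oplus>\<^bsub>B\<^esub> j) | a j. a \<in> carrier A \<and> j \<in> J}"

definition amalgamation ::
    "('a, 'm) ring_scheme \<Rightarrow> ('b, 'n) ring_scheme \<Rightarrow> ('a \<Rightarrow> 'b) \<Rightarrow> 'b set \<Rightarrow> ('a \<times> 'b) ring"
  where "amalgamation A B f J = (RDirProd A B)\<lparr>carrier := amalg_set A B f J\<rparr>"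

definition bezout_ring :: "('a, 'm) ring_scheme \<Rightarrow> bool"
  where "bezout_ring R \<longleftrightarrow>
    cring R \<and> (\<forall>S. finite S \<longrightarrow> S \<subseteq> carrier R \<longrightarrow> principalideal (Idl\<^bsub>R\<^esub> S) R)"

text \<open>
  The type \<open>'a mat\<close> serves only as a container of entries: its arithmetic in \<open>Matrix\<close> uses the
  type class operations on \<open>'a\<close>, so product and identity over a ring record are defined here.
\<close>

definition mats_over :: "('a, 'm) ring_scheme \<Rightarrow> nat \<Rightarrow> nat \<Rightarrow> 'a mat set"
  where "mats_over R m n = {M \<in> carrier_mat m n. elements_mat M \<subseteq> carrier R}"

definition mult_mat_over :: "('a, 'm) ring_scheme \<Rightarrow> 'a mat \<Rightarrow> 'a mat \<Rightarrow> 'a mat"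
  where "mult_mat_over R M N =
    mat (dim_row M) (dim_col N)
      (\<lambda>(i, k). \<Oplus>\<^bsub>R\<^esub>j\<in>{..<dim_row N}. M $$ (i, j) \<otimes>\<^bsub>R\<^esub> N $$ (j, k))"

definition one_mat_over :: "('a, 'm) ring_scheme \<Rightarrow> nat \<Rightarrow> 'a mat"
  where "one_mat_over R n = mat n n (\<lambda>(i, j). if i = j then \<one>\<^bsub>R\<^esub> else \<zero>\<^bsub>R\<^esub>)"

definition nonsingular_mat :: "('a, 'm) ring_scheme \<Rightarrow> nat \<Rightarrow> 'a mat \<Rightarrow> bool"
  where "nonsingular_mat R n Q \<longleftrightarrow>
    Q \<in> mats_over R n n \<and>
    (\<exists>P \<in> mats_over R n n.
      mult_mat_over R Q P = one_mat_over R n \<and> mult_mat_over R P Q = one_mat_over R n)"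

text \<open>
  Matrices need not be square. As \<open>Q\<close> acts on the right in the definition of an Hermite ring,
  triangular means lower triangular (Kaplansky's convention); every one-row matrix is trivially
  upper triangular, whereas \<open>(a b) Q = (d 0)\<close> is the content of the notion.
\<close>

definition triangular_mat :: "('a, 'm) ring_scheme \<Rightarrow> 'a mat \<Rightarrow> bool"
  where "triangular_mat R M \<longleftrightarrow>
    (\<forall>i < dim_row M. \<forall>j < dim_col M. i < j \<longrightarrow> M $$ (i, j) = \<zero>\<^bsub>R\<^esub>)"

definition hermite_ring :: "('a, 'm) ring_scheme \<Rightarrow> bool"
  where "hermite_ring R \<longleftrightarrow>
    cring R \<and>
    (\<forall>m n. \<forall>M \<in> mats_over R m n.
      \<exists>Q. nonsingular_mat R n Q \<and> triangular_mat R (mult_mat_over R M Q))"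

lemma RDirProd_simps:
  "(a, b) \<oplus>\<^bsub>RDirProd A B\<^esub> (c, d) = (a \<oplus>\<^bsub>A\<^esub> c, b \<oplus>\<^bsub>B\<^esub> d)"
  "(a, b) \<otimes>\<^bsub>RDirProd A B\<^esub> (c, d) = (a \<otimes>\<^bsub>A\<^esub> c, b \<otimes>\<^bsub>B\<^esub> d)"
  "\<one>\<^bsub>RDirProd A B\<^esub> = (\<one>\<^bsub>A\<^esub>, \<one>\<^bsub>B\<^esub>)"
  "\<zero>\<^bsub>RDirProd A B\<^esub> = (\<zero>\<^bsub>A\<^esub>, \<zero>\<^bsub>B\<^esub>)"
  by (simp_all add: RDirProd_def DirProd_def monoid.defs)

lemma RDirProd_cring:
  assumes "cring A" "cring B"
  shows "cring (RDirProd A B)"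
proof -
  interpret A: cring A by fact
  interpret B: cring B by fact
  interpret P: ring "RDirProd A B"
    using RDirProd_ring A.ring_axioms B.ring_axioms by blast
  show ?thesis
    by unfold_locales (auto simp: RDirProd_carrier RDirProd_simps A.m_comm B.m_comm)
qed

lemma amalg_set_subring:
  assumes "cring A" "cring B" "f \<in> ring_hom A B" "ideal J B"
  shows "subring (amalg_set A B f J) (RDirProd A B)"
proof -
  interpret A: cring A by fact
  interpret B: cring B by fact
  interpret J: ideal J B by fact
  interpret f: ring_hom_cring A B f
    using assms by (simp add: ring_hom_cring_def ring_hom_cring_axioms_def)
  interpret P: cring "RDirProd A B"
    using RDirProd_cring assms by blast
  have J: "j \<in> carrier B" if "j \<in> J" for j
    using that J.a_subset by blast
  have minus: "\<ominus>\<^bsub>RDirProd A B\<^esub> (a, b) = (\<ominus>\<^bsub>A\<^esub> a, \<ominus>\<^bsub>B\<^esub> b)"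
    if "a \<in> carrier A" "b \<in> carrier B" for a b
    using that
    by (intro P.minus_equality) (auto simp: RDirProd_carrier RDirProd_simps A.l_neg B.l_neg)
  show ?thesis
  proof (rule P.subringI)
    show "amalg_set A B f J \<subseteq> carrier (RDirProd A B)"
      by (auto simp: amalg_set_def RDirProd_carrier J)
    show "\<one>\<^bsub>RDirProd A B\<^esub> \<in> amalg_set A B f J"
      unfolding amalg_set_def RDirProd_simps
      by (rule CollectI, rule exI[of _ "\<one>\<^bsub>A\<^esub>"], rule exI[of _ "\<zero>\<^bsub>B\<^esub>"]) auto
  next
    fix h assume "h \<in> amalg_set A B f J"
    then obtain a j where h: "h = (a, f a \<oplus>\<^bsub>B\<^esub> j)" "a \<in> carrier A" "j \<in> J"
      by (auto simp: amalg_set_def)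
    then have "\<ominus>\<^bsub>RDirProd A B\<^esub> h = (\<ominus>\<^bsub>A\<^esub> a, f (\<ominus>\<^bsub>A\<^esub> a) \<oplus>\<^bsub>B\<^esub> (\<ominus>\<^bsub>B\<^esub> j))"
      by (simp add: minus J B.minus_add)
    with h show "\<ominus>\<^bsub>RDirProd A B\<^esub> h \<in> amalg_set A B f J"
      unfolding amalg_set_def by blast
  next
    fix h k assume "h \<in> amalg_set A B f J" "k \<in> amalg_set A B f J"
    then obtain a i b j where
      h: "h = (a, f a \<oplus>\<^bsub>B\<^esub> i)" "a \<in> carrier A" "i \<in> J" and
      k: "k = (b, f b \<oplus>\<^bsub>B\<^esub> j)" "b \<in> carrier A" "j \<in> J"
      by (auto simp: amalg_set_def)
    have "h \<oplus>\<^bsub>RDirProd A B\<^esub> k = (a \<oplus>\<^bsub>A\<^esub> b, f (a \<oplus>\<^bsub>A\<^esub> b) \<oplus>\<^bsub>B\<^esub> (i \<oplus>\<^bsub>B\<^esub> j))"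
      using h k by (simp add: RDirProd_simps J B.a_ac)
    with h k show "h \<oplus>\<^bsub>RDirProd A B\<^esub> k \<in> amalg_set A B f J"
      unfolding amalg_set_def by blast
    let ?l = "f a \<otimes>\<^bsub>B\<^esub> j \<oplus>\<^bsub>B\<^esub> (i \<otimes>\<^bsub>B\<^esub> f b \<oplus>\<^bsub>B\<^esub> i \<otimes>\<^bsub>B\<^esub> j)"
    have "?l \<in> J"
      using h k by (intro J.a_closed J.I_l_closed J.I_r_closed) (auto simp: J)
    moreover have "h \<otimes>\<^bsub>RDirProd A B\<^esub> k = (a \<otimes>\<^bsub>A\<^esub> b, f (a \<otimes>\<^bsub>A\<^esub> b) \<oplus>\<^bsub>B\<^esub> ?l)"
      using h k by (simp add: RDirProd_simps J B.l_distr B.r_distr B.a_ac)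
    ultimately show "h \<otimes>\<^bsub>RDirProd A B\<^esub> k \<in> amalg_set A B f J"
      using h k unfolding amalg_set_def by blast
  qed
qed

lemma amalgamation_cring:
  assumes "cring A" "cring B" "f \<in> ring_hom A B" "ideal J B"
  shows "cring (amalgamation A B f J)"
  unfolding amalgamation_def
  using cring.subcringI'[OF RDirProd_cring amalg_set_subring] ring.subcring_iff
    RDirProd_cring cring.axioms(1) subringE(1)[OF amalg_set_subring] assms
  by metis

end

theory Submission
  imports Defs
begin

text \<open>
  Kaplansky's condition (every pair \<open>a, b\<close> can be written \<open>a = a'd\<close>, \<open>b = b'd\<close> with \<open>a', b'\<close>
  comaximal) yields an invertible 2x2 matrix sending the row \<open>(a, b)\<close> to \<open>(d, 0)\<close>, hence the
  Hermite property; the Hermite property applied to \<open>1 x 2\<close> matrices yields the Bezout property.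
  Bezout domains satisfy Kaplansky's condition, and it passes to products and isomorphic copies,
  which settles the cases \<open>J = B\<close> (where the amalgamation is \<open>A \<times> B\<close>) and \<open>J = 0\<close> (where it is
  isomorphic to \<open>A\<close>). Conversely, \<open>A\<close> is a quotient of the amalgamation, and if \<open>J \<noteq> 0\<close> then a
  generator of the ideal spanned by \<open>(a, 0)\<close> and \<open>(0, j)\<close>, where \<open>f a = 0\<close> and \<open>a, j\<close> are
  nonzero, produces a unit of \<open>B\<close> in \<open>J\<close>.
\<close>

section \<open>Matrices over a commutative ring\<close>

lemma mats_overI:
  assumes "\<And>i j. i < m \<Longrightarrow> j < n \<Longrightarrow> f (i, j) \<in> carrier R"
  shows "mat m n f \<in> mats_over R m n"
  using assms by (auto simp: mats_over_def dest!: elements_matD)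

lemma mats_over_entry:
  assumes "M \<in> mats_over R m n" "i < m" "j < n"
  shows "M $$ (i, j) \<in> carrier R"
  using assms unfolding mats_over_def by blast

lemma mats_over_dim:
  assumes "M \<in> mats_over R m n"
  shows "dim_row M = m" "dim_col M = n"
  using assms unfolding mats_over_def by auto

lemma mats_over_eqI:
  assumes "M \<in> mats_over R m n" "N \<in> mats_over R m n"
    and "\<And>i j. i < m \<Longrightarrow> j < n \<Longrightarrow> M $$ (i, j) = N $$ (i, j)"
  shows "M = N"
  using assms by (intro eq_matI) (auto simp: mats_over_dim)

lemma mult_mat_over_entry:
  assumes "M \<in> mats_over R m n" "N \<in> mats_over R n p" "i < m" "k < p"
  shows "mult_mat_over R M N $$ (i, k) = (\<Oplus>\<^bsub>R\<^esub>j\<in>{..<n}. M $$ (i, j) \<otimes>\<^bsub>R\<^esub> N $$ (j, k))"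
  using assms by (simp add: mult_mat_over_def mats_over_dim)

context cring
begin

lemma one_mat_over_closed: "one_mat_over R n \<in> mats_over R n n"
  unfolding one_mat_over_def by (rule mats_overI) auto

lemma mult_mat_over_closed:
  assumes M: "M \<in> mats_over R m n" and N: "N \<in> mats_over R n p"
  shows "mult_mat_over R M N \<in> mats_over R m p"
  unfolding mult_mat_over_def mats_over_dim[OF M] mats_over_dim[OF N]
  using mats_over_entry[OF M] mats_over_entry[OF N]
  by (intro mats_overI) (auto intro!: finsum_closed)

text \<open>Induction on the first index set; splitting off one index adds one term to every inner
  sum on the right.\<close>

lemma finsum_swap:
  assumes "finite A" "finite B" "\<And>i j. i \<in> A \<Longrightarrow> j \<in> B \<Longrightarrow> g i j \<in> carrier R"
  shows "(\<Oplus>i\<in>A. \<Oplus>j\<in>B. g i j) = (\<Oplus>j\<in>B. \<Oplus>i\<in>A. g i j)"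
  using assms(1,3)
proof (induction A rule: finite_induct)
  case empty
  show ?case by (simp add: finsum_zero)
next
  case (insert a A)
  have "(\<Oplus>j\<in>B. \<Oplus>i\<in>insert a A. g i j) = (\<Oplus>j\<in>B. g a j \<oplus> (\<Oplus>i\<in>A. g i j))"
    using insert by (intro finsum_cong') (auto intro!: finsum_closed finsum_insert)
  also have "\<dots> = (\<Oplus>j\<in>B. g a j) \<oplus> (\<Oplus>j\<in>B. \<Oplus>i\<in>A. g i j)"
    using insert by (intro finsum_addf) (auto intro!: finsum_closed)
  finally show ?case
    using insert by (simp add: finsum_closed Pi_def)
qed

text \<open>Both entries in position \<open>(i, l)\<close> are the double sum of the products
  \<open>M_ij N_jk P_kl\<close>; the two groupings differ by the order of summation.\<close>

lemma mult_mat_over_assoc: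
  assumes M: "M \<in> mats_over R m n" and N: "N \<in> mats_over R n p" and P: "P \<in> mats_over R p q"
  shows "mult_mat_over R (mult_mat_over R M N) P = mult_mat_over R M (mult_mat_over R N P)"
proof (rule mats_over_eqI)
  note MN = mult_mat_over_closed[OF M N] and NP = mult_mat_over_closed[OF N P]
  show "mult_mat_over R (mult_mat_over R M N) P \<in> mats_over R m q"
    "mult_mat_over R M (mult_mat_over R N P) \<in> mats_over R m q"
    using mult_mat_over_closed M N P by blast+
  fix i l assume il: "i < m" "l < q"
  note c = mats_over_entry[OF M] mats_over_entry[OF N] mats_over_entry[OF P]
  have "mult_mat_over R (mult_mat_over R M N) P $$ (i, l)
      = (\<Oplus>k\<in>{..<p}. (\<Oplus>j\<in>{..<n}. M $$ (i, j) \<otimes> N $$ (j, k)) \<otimes> P $$ (k, l))"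
    unfolding mult_mat_over_entry[OF MN P il] using il c
    by (intro finsum_cong') (auto simp: mult_mat_over_entry[OF M N] intro!: finsum_closed)
  also have "\<dots> = (\<Oplus>k\<in>{..<p}. \<Oplus>j\<in>{..<n}. M $$ (i, j) \<otimes> N $$ (j, k) \<otimes> P $$ (k, l))"
    using il c by (intro finsum_cong') (auto intro!: finsum_closed finsum_ldistr)
  also have "\<dots> = (\<Oplus>j\<in>{..<n}. \<Oplus>k\<in>{..<p}. M $$ (i, j) \<otimes> N $$ (j, k) \<otimes> P $$ (k, l))"
    using il c by (intro finsum_swap) auto
  also have "\<dots> = (\<Oplus>j\<in>{..<n}. \<Oplus>k\<in>{..<p}. M $$ (i, j) \<otimes> (N $$ (j, k) \<otimes> P $$ (k, l)))"
    using il c by (intro finsum_cong') (auto intro!: finsum_closed finsum_cong' simp: m_assoc)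
  also have "\<dots> = (\<Oplus>j\<in>{..<n}. M $$ (i, j) \<otimes> (\<Oplus>k\<in>{..<p}. N $$ (j, k) \<otimes> P $$ (k, l)))"
    using il c by (intro finsum_cong') (auto intro!: finsum_closed finsum_rdistr[symmetric])
  also have "\<dots> = mult_mat_over R M (mult_mat_over R N P) $$ (i, l)"
    unfolding mult_mat_over_entry[OF M NP il] using il c
    by (intro finsum_cong') (auto simp: mult_mat_over_entry[OF N P] intro!: finsum_closed)
  finally show "mult_mat_over R (mult_mat_over R M N) P $$ (i, l)
      = mult_mat_over R M (mult_mat_over R N P) $$ (i, l)" .
qed

lemma mult_mat_over_one:
  assumes M: "M \<in> mats_over R m n"
  shows "mult_mat_over R M (one_mat_over R n) = M"
proof (rule mats_over_eqI[OF mult_mat_over_closed[OF M one_mat_over_closed] M])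
  fix i k assume ik: "i < m" "k < n"
  have "(\<Oplus>j\<in>{..<n}. M $$ (i, j) \<otimes> one_mat_over R n $$ (j, k))
      = (\<Oplus>j\<in>{..<n}. if k = j then M $$ (i, j) else \<zero>)"
    using ik mats_over_entry[OF M] by (intro finsum_cong') (auto simp: one_mat_over_def)
  also have "\<dots> = M $$ (i, k)"
    using ik mats_over_entry[OF M] by (intro finsum_singleton) auto
  finally show "mult_mat_over R M (one_mat_over R n) $$ (i, k) = M $$ (i, k)"
    by (simp add: mult_mat_over_entry[OF M one_mat_over_closed ik])
qed

section \<open>Invertible matrices form a monoid\<close>

lemma nonsingular_mat_one: "nonsingular_mat R n (one_mat_over R n)"
  unfolding nonsingular_mat_def
  using one_mat_over_closed mult_mat_over_one[OF one_mat_over_closed] by blast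

text \<open>The inverse is the product of the inverses in reverse order. The auxiliary fact
  \<open>cancel\<close> keeps its four matrices arbitrary so that it covers the left and the right
  inverse alike.\<close>

lemma nonsingular_mat_mult:
  assumes "nonsingular_mat R n Q" "nonsingular_mat R n Q'"
  shows "nonsingular_mat R n (mult_mat_over R Q Q')"
proof -
  have cancel: "mult_mat_over R (mult_mat_over R X Y) (mult_mat_over R Z W) = one_mat_over R n"
    if "X \<in> mats_over R n n" "Y \<in> mats_over R n n" "Z \<in> mats_over R n n" "W \<in> mats_over R n n"
      "mult_mat_over R Y Z = one_mat_over R n" "mult_mat_over R X W = one_mat_over R n"
    for X Y Z W
  proof -
    have "mult_mat_over R (mult_mat_over R X Y) (mult_mat_over R Z W)
        = mult_mat_over R (mult_mat_over R X (mult_mat_over R Y Z)) W"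
      using that(1-4) by (simp add: mult_mat_over_assoc[where m = n and n = n and p = n and q = n]
        mult_mat_over_closed[where m = n and n = n and p = n])
    then show ?thesis
      using that by (simp add: mult_mat_over_one)
  qed
  show ?thesis
    using assms cancel mult_mat_over_closed[where m = n and n = n and p = n]
    unfolding nonsingular_mat_def by blast
qed

section \<open>Column operations\<close>

text \<open>The identity matrix with the 2x2 block \<open>a b; c d\<close> in rows and columns \<open>p\<close>, \<open>q\<close>.\<close>

definition block_mat :: "nat \<Rightarrow> nat \<Rightarrow> nat \<Rightarrow> 'a \<Rightarrow> 'a \<Rightarrow> 'a \<Rightarrow> 'a \<Rightarrow> 'a mat"
  where "block_mat n p q a b c d = mat n n (\<lambda>(i, j).
    if j = p then (if i = p then a else if i = q then c else \<zero>)
    else if j = q then (if i = p then b else if i = q then d else \<zero>)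
    else if i = j then \<one> else \<zero>)"

lemma block_mat_closed:
  assumes "a \<in> carrier R" "b \<in> carrier R" "c \<in> carrier R" "d \<in> carrier R"
  shows "block_mat n p q a b c d \<in> mats_over R n n"
  unfolding block_mat_def using assms by (intro mats_overI) auto

lemma finsum_two_terms:
  assumes "finite A" "p \<in> A" "q \<in> A" "p \<noteq> q" "g \<in> A \<rightarrow> carrier R"
    and "\<And>j. j \<in> A \<Longrightarrow> j \<noteq> p \<Longrightarrow> j \<noteq> q \<Longrightarrow> g j = \<zero>"
  shows "(\<Oplus>j\<in>A. g j) = g p \<oplus> g q"
proof -
  have "(\<Oplus>j\<in>A. g j) = (\<Oplus>j\<in>{p, q}. g j)"
    using assms by (intro add.finprod_mono_neutral_cong_right) auto
  also have "\<dots> = g p \<oplus> g q"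
    using assms by (subst finsum_insert) (auto simp: Pi_def)
  finally show ?thesis .
qed

text \<open>Columns \<open>p\<close> and \<open>q\<close> of the block matrix are supported on rows
  \<open>p\<close> and \<open>q\<close>, which leaves two terms of the sum; every other column is a
  unit vector.\<close>

lemma mult_block_mat_entry:
  assumes M: "M \<in> mats_over R m n" and pq: "p < n" "q < n" "p \<noteq> q"
    and abcd: "a \<in> carrier R" "b \<in> carrier R" "c \<in> carrier R" "d \<in> carrier R"
    and ij: "i < m" "j < n"
  shows "mult_mat_over R M (block_mat n p q a b c d) $$ (i, j) =
    (if j = p then M $$ (i, p) \<otimes> a \<oplus> M $$ (i, q) \<otimes> c
     else if j = q then M $$ (i, p) \<otimes> b \<oplus> M $$ (i, q) \<otimes> d
     else M $$ (i, j))"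
proof -
  let ?E = "block_mat n p q a b c d"
  note c = mats_over_entry[OF M] abcd
  have E: "mult_mat_over R M ?E $$ (i, j) = (\<Oplus>k\<in>{..<n}. M $$ (i, k) \<otimes> ?E $$ (k, j))"
    by (rule mult_mat_over_entry[OF M block_mat_closed[OF abcd] ij])
  show ?thesis
  proof (cases "j = p \<or> j = q")
    case True
    have "(\<Oplus>k\<in>{..<n}. M $$ (i, k) \<otimes> ?E $$ (k, j))
        = M $$ (i, p) \<otimes> ?E $$ (p, j) \<oplus> M $$ (i, q) \<otimes> ?E $$ (q, j)"
      using True c ij pq by (intro finsum_two_terms) (auto simp: block_mat_def)
    with E True pq show ?thesis by (auto simp: block_mat_def)
  next
    case False
    have "(\<Oplus>k\<in>{..<n}. M $$ (i, k) \<otimes> ?E $$ (k, j))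
        = (\<Oplus>k\<in>{..<n}. if j = k then M $$ (i, k) else \<zero>)"
      using False c ij by (intro finsum_cong') (auto simp: block_mat_def)
    also have "\<dots> = M $$ (i, j)"
      using c ij by (intro finsum_singleton) auto
    finally show ?thesis using E False by simp
  qed
qed

text \<open>The product is governed by the 2x2 blocks, and \<open>eqs\<close> says that these
  multiply to the 2x2 identity.\<close>

lemma mult_block_mat_inverse:
  assumes pq: "p < n" "q < n" "p \<noteq> q"
    and abcd: "a \<in> carrier R" "b \<in> carrier R" "c \<in> carrier R" "d \<in> carrier R"
    and abcd': "a' \<in> carrier R" "b' \<in> carrier R" "c' \<in> carrier R" "d' \<in> carrier R"
    and eqs: "a \<otimes> a' \<oplus> b \<otimes> c' = \<one>" "a \<otimes> b' \<oplus> b \<otimes> d' = \<zero>"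
      "c \<otimes> a' \<oplus> d \<otimes> c' = \<zero>" "c \<otimes> b' \<oplus> d \<otimes> d' = \<one>"
  shows "mult_mat_over R (block_mat n p q a b c d) (block_mat n p q a' b' c' d')
    = one_mat_over R n"
proof (rule mats_over_eqI)
  note E = block_mat_closed[OF abcd] and E' = block_mat_closed[OF abcd']
  show "mult_mat_over R (block_mat n p q a b c d) (block_mat n p q a' b' c' d')
      \<in> mats_over R n n" "one_mat_over R n \<in> mats_over R n n"
    using mult_mat_over_closed[OF E E'] one_mat_over_closed by auto
  fix i j assume ij: "i < n" "j < n"
  show "mult_mat_over R (block_mat n p q a b c d) (block_mat n p q a' b' c' d') $$ (i, j)
      = one_mat_over R n $$ (i, j)"
    unfolding mult_block_mat_entry[OF E pq abcd' ij]
    using pq ij eqs abcd abcd' by (auto simp: block_mat_def one_mat_over_def)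
qed

section \<open>Kaplansky's condition and triangularization\<close>

text \<open>Comaximality of \<open>a'\<close> and \<open>b'\<close> is spelled out by coefficients
  \<open>s\<close> and \<open>t\<close> because these become entries of the clearing matrix.\<close>

definition hermite_pair :: "'a \<Rightarrow> 'a \<Rightarrow> bool"
  where "hermite_pair a b \<longleftrightarrow>
    (\<exists>a' \<in> carrier R. \<exists>b' \<in> carrier R. \<exists>d \<in> carrier R. \<exists>s \<in> carrier R. \<exists>t \<in> carrier R.
      a = a' \<otimes> d \<and> b = b' \<otimes> d \<and> a' \<otimes> s \<oplus> b' \<otimes> t = \<one>)"

lemma hermite_pairI:
  assumes "a' \<in> carrier R" "b' \<in> carrier R" "d \<in> carrier R" "s \<in> carrier R" "t \<in> carrier R"
    "a = a' \<otimes> d" "b = b' \<otimes> d" "a' \<otimes> s \<oplus> b' \<otimes> t = \<one>"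
  shows "hermite_pair a b"
  using assms unfolding hermite_pair_def by blast

lemma hermite_pairE:
  assumes "hermite_pair a b"
  obtains a' b' d s t
  where "a' \<in> carrier R" "b' \<in> carrier R" "d \<in> carrier R" "s \<in> carrier R" "t \<in> carrier R"
    "a = a' \<otimes> d" "b = b' \<otimes> d" "a' \<otimes> s \<oplus> b' \<otimes> t = \<one>"
  using assms unfolding hermite_pair_def by (elim bexE conjE) (rule that)

text \<open>A column operation on columns \<open>p\<close> and \<open>q\<close> turns the pair
  \<open>(a d, b d)\<close> in row \<open>r\<close> into \<open>(d, 0)\<close>. The last two
  conclusions ensure that zeros obtained earlier survive: other columns are untouched, and a row
  that vanishes in both columns still does.\<close>

lemma exists_clearing_mat:
  assumes K: "\<And>a b. a \<in> carrier R \<Longrightarrow> b \<in> carrier R \<Longrightarrow> hermite_pair a b"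
    and M: "M \<in> mats_over R m n" and pq: "p < n" "q < n" "p \<noteq> q" and r: "r < m"
  obtains E where "nonsingular_mat R n E" "mult_mat_over R M E $$ (r, q) = \<zero>"
    "\<And>i j. i < m \<Longrightarrow> j < n \<Longrightarrow> j \<noteq> p \<Longrightarrow> j \<noteq> q \<Longrightarrow> mult_mat_over R M E $$ (i, j) = M $$ (i, j)"
    "\<And>i j. i < m \<Longrightarrow> j \<in> {p, q} \<Longrightarrow> M $$ (i, p) = \<zero> \<Longrightarrow> M $$ (i, q) = \<zero> \<Longrightarrow>
      mult_mat_over R M E $$ (i, j) = \<zero>"
proof -
  have "hermite_pair (M $$ (r, p)) (M $$ (r, q))"
    using mats_over_entry[OF M] r pq by (intro K) auto
  then obtain a b d s t
    where c: "a \<in> carrier R" "b \<in> carrier R" "d \<in> carrier R" "s \<in> carrier R" "t \<in> carrier R"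
      and M_rp: "M $$ (r, p) = a \<otimes> d" and M_rq: "M $$ (r, q) = b \<otimes> d"
      and one: "a \<otimes> s \<oplus> b \<otimes> t = \<one>"
    by (rule hermite_pairE)
  have c': "\<ominus> b \<in> carrier R" "\<ominus> t \<in> carrier R" using c by auto
  \<comment> \<open>The block of \<open>E\<close> has determinant \<open>a s + b t = 1\<close>; the
    block of \<open>E'\<close> is its adjugate, hence its inverse.\<close>
  define E where "E = block_mat n p q s (\<ominus> b) t a"
  define E' where "E' = block_mat n p q a b (\<ominus> t) s"
  have E: "E \<in> mats_over R n n" and E': "E' \<in> mats_over R n n"
    unfolding E_def E'_def using c c' by (auto intro: block_mat_closed)
  have one': "s \<otimes> a \<oplus> t \<otimes> b = \<one>"
    using one c by (simp add: m_comm)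
  have "mult_mat_over R E E' = one_mat_over R n"
    unfolding E_def E'_def
  proof (rule mult_block_mat_inverse[OF pq])
    show "s \<otimes> a \<oplus> \<ominus> b \<otimes> \<ominus> t = \<one>" using one c by algebra
    show "s \<otimes> b \<oplus> \<ominus> b \<otimes> s = \<zero>" using c by algebra
    show "t \<otimes> a \<oplus> a \<otimes> \<ominus> t = \<zero>" using c by algebra
    show "t \<otimes> b \<oplus> a \<otimes> s = \<one>" using one c by algebra
  qed (use c c' in auto)
  moreover have "mult_mat_over R E' E = one_mat_over R n"
    unfolding E_def E'_def
  proof (rule mult_block_mat_inverse[OF pq])
    show "a \<otimes> s \<oplus> b \<otimes> t = \<one>" by (rule one)
    show "a \<otimes> \<ominus> b \<oplus> b \<otimes> a = \<zero>" using c by algebra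
    show "\<ominus> t \<otimes> s \<oplus> s \<otimes> t = \<zero>" using c by algebra
    show "\<ominus> t \<otimes> \<ominus> b \<oplus> s \<otimes> a = \<one>" using one c by algebra
  qed (use c c' in auto)
  ultimately have "nonsingular_mat R n E"
    unfolding nonsingular_mat_def using E E' by blast
  moreover note entry = mult_block_mat_entry[OF M pq c(4) c'(1) c(5) c(1), folded E_def]
  have "a \<otimes> d \<otimes> \<ominus> b \<oplus> b \<otimes> d \<otimes> a = \<zero>" using c by algebra
  then have "mult_mat_over R M E $$ (r, q) = \<zero>"
    using entry[OF r pq(2)] pq M_rp M_rq by simp
  ultimately show thesis
    using c c' pq by (intro that[of E]) (auto simp: entry)
qed

text \<open>
  Entries above the diagonal are cleared row by row. Clearing the entry in position \<open>(r, k)\<close>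
  against the diagonal one only changes columns that vanish in the rows above \<open>r\<close>.
\<close>

lemma exists_triangularizing_mat:
  assumes K: "\<And>a b. a \<in> carrier R \<Longrightarrow> b \<in> carrier R \<Longrightarrow> hermite_pair a b"
    and M: "M \<in> mats_over R m n"
  shows "\<exists>Q. nonsingular_mat R n Q \<and> triangular_mat R (mult_mat_over R M Q)"
proof -
  \<comment> \<open>The state of the elimination: above the diagonal, all rows before
    \<open>r\<close> are zero, and row \<open>r\<close> is zero to the left of column
    \<open>k\<close>.\<close>
  define cleared where "cleared r k N \<longleftrightarrow>
    (\<forall>i<m. \<forall>j<n. i < j \<and> (i < r \<or> i = r \<and> j < k) \<longrightarrow> N $$ (i, j) = \<zero>)"
    for r k and N :: "'a mat"
  have closed: "mult_mat_over R M Q \<in> mats_over R m n" if "nonsingular_mat R n Q" for Q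
    using that mult_mat_over_closed[OF M] unfolding nonsingular_mat_def by blast
  have columns: "\<exists>Q. nonsingular_mat R n Q \<and> cleared r k (mult_mat_over R M Q)"
    if "k \<le> n" "r < m" "\<exists>Q. nonsingular_mat R n Q \<and> cleared r 0 (mult_mat_over R M Q)" for r k
    using that(1)
  proof (induction k)
    case 0
    show ?case using that(3) .
  next
    case (Suc k)
    then obtain Q where Q: "nonsingular_mat R n Q" and N: "cleared r k (mult_mat_over R M Q)"
      by auto
    show ?case
    proof (cases "r < k")
      \<comment> \<open>Position \<open>(r, k)\<close> is not strictly above the diagonal, so the
        same \<open>Q\<close> serves.\<close>
      case False
      then have "cleared r (Suc k) (mult_mat_over R M Q)"
        using N by (auto simp: cleared_def less_Suc_eq)
      with Q show ?thesis by blast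
    next
      case True
      let ?N = "mult_mat_over R M Q"
      \<comment> \<open>Since \<open>r < k < n\<close>, the diagonal column \<open>r\<close> exists
        even when the matrix is not square.\<close>
      have rk: "r < n" "k < n" "r \<noteq> k" using True Suc.prems by auto
      obtain E where E: "nonsingular_mat R n E" "mult_mat_over R ?N E $$ (r, k) = \<zero>"
        and keep: "\<And>i j. i < m \<Longrightarrow> j < n \<Longrightarrow> j \<noteq> r \<Longrightarrow> j \<noteq> k \<Longrightarrow>
          mult_mat_over R ?N E $$ (i, j) = ?N $$ (i, j)"
        and zero: "\<And>i j. i < m \<Longrightarrow> j \<in> {r, k} \<Longrightarrow> ?N $$ (i, r) = \<zero> \<Longrightarrow> ?N $$ (i, k) = \<zero> \<Longrightarrow>
          mult_mat_over R ?N E $$ (i, j) = \<zero>"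
        using exists_clearing_mat[OF K closed[OF Q] rk \<open>r < m\<close>] by metis
      have "cleared r (Suc k) (mult_mat_over R ?N E)"
        unfolding cleared_def
      proof (intro allI impI, elim conjE)
        fix i j
        assume ij: "i < m" "j < n" "i < j" and "i < r \<or> i = r \<and> j < Suc k"
        \<comment> \<open>The entry just cleared, the two changed columns in the rows above, and the
          unchanged columns.\<close>
        then consider "i = r" "j = k" | "i < r" "j \<in> {r, k}"
          | "j \<noteq> r" "j \<noteq> k" "i < r \<or> i = r \<and> j < k"
          by fastforce
        then show "mult_mat_over R ?N E $$ (i, j) = \<zero>"
        proof cases
          case 1
          then show ?thesis using E by simp
        next
          case 2
          \<comment> \<open>Here \<open>i < r < k\<close>, so both entries lie above the diagonal in
            a finished row.\<close>
          then have "?N $$ (i, r) = \<zero>" "?N $$ (i, k) = \<zero>"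
            using N ij rk True unfolding cleared_def by auto
          then show ?thesis using zero ij 2 by blast
        next
          case 3
          then show ?thesis using keep N ij unfolding cleared_def by simp
        qed
      qed
      moreover have "mult_mat_over R ?N E = mult_mat_over R M (mult_mat_over R Q E)"
        using mult_mat_over_assoc[OF M, of Q n E n] Q E(1) unfolding nonsingular_mat_def by simp
      ultimately show ?thesis
        using nonsingular_mat_mult[OF Q E(1)] by auto
    qed
  qed
  have "\<exists>Q. nonsingular_mat R n Q \<and> cleared r 0 (mult_mat_over R M Q)" if "r \<le> m" for r
    using that
  proof (induction r)
    case 0
    show ?case using nonsingular_mat_one by (auto simp: cleared_def)
  next
    case (Suc r)
    then obtain Q where "nonsingular_mat R n Q" "cleared r n (mult_mat_over R M Q)"
      using columns[of n r] by auto
    \<comment> \<open>A finished row \<open>r\<close> is the start of the next one: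
      \<open>cleared r n\<close> amounts to \<open>cleared (Suc r) 0\<close>.\<close>
    then show ?case
      by (intro exI[of _ Q]) (auto simp: cleared_def less_Suc_eq)
  qed
  from this[of m] obtain Q where "nonsingular_mat R n Q" "cleared m 0 (mult_mat_over R M Q)"
    by auto
  then show ?thesis
    by (intro exI[of _ Q]) (simp add: triangular_mat_def cleared_def mats_over_dim[OF closed])
qed

lemma hermite_ringI:
  assumes "\<And>a b. a \<in> carrier R \<Longrightarrow> b \<in> carrier R \<Longrightarrow> hermite_pair a b"
  shows "hermite_ring R"
  unfolding hermite_ring_def using exists_triangularizing_mat[OF assms] cring_axioms by blast

section \<open>Ideals with two generators\<close>

text \<open>This says that the ideal generated by \<open>a\<close> and \<open>b\<close> is generated
  by \<open>d\<close>. Written as equations with explicit coefficients, it passes along a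
  projection.\<close>

definition bezout_pair :: "'a \<Rightarrow> 'a \<Rightarrow> bool"
  where "bezout_pair a b \<longleftrightarrow>
    (\<exists>d \<in> carrier R. \<exists>x \<in> carrier R. \<exists>y \<in> carrier R. \<exists>u \<in> carrier R. \<exists>v \<in> carrier R.
      a = d \<otimes> x \<and> b = d \<otimes> y \<and> d = a \<otimes> u \<oplus> b \<otimes> v)"

lemma bezout_pairI:
  assumes "d \<in> carrier R" "x \<in> carrier R" "y \<in> carrier R" "u \<in> carrier R" "v \<in> carrier R"
    "a = d \<otimes> x" "b = d \<otimes> y" "d = a \<otimes> u \<oplus> b \<otimes> v"
  shows "bezout_pair a b"
  using assms unfolding bezout_pair_def by blast

lemma bezout_pairE:
  assumes "bezout_pair a b"
  obtains d x y u v
  where "d \<in> carrier R" "x \<in> carrier R" "y \<in> carrier R" "u \<in> carrier R" "v \<in> carrier R"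
    "a = d \<otimes> x" "b = d \<otimes> y" "d = a \<otimes> u \<oplus> b \<otimes> v"
  using assms unfolding bezout_pair_def by (elim bexE conjE) (rule that)

lemma mem_Idl_singleton:
  assumes "d \<in> carrier R" shows "x \<in> Idl {d} \<longleftrightarrow> (\<exists>y \<in> carrier R. x = d \<otimes> y)"
  using assms unfolding cgenideal_eq_genideal[OF assms, symmetric] cgenideal_def
  by (auto simp: m_comm)

text \<open>Two generators can be merged into one, so induction on a finite generating set reduces
  everything to pairs.\<close>

lemma bezout_ring_iff:
  "bezout_ring R \<longleftrightarrow> (\<forall>a \<in> carrier R. \<forall>b \<in> carrier R. bezout_pair a b)"
proof
  assume B: "bezout_ring R"
  show "\<forall>a \<in> carrier R. \<forall>b \<in> carrier R. bezout_pair a b"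
  proof (intro ballI)
    fix a b assume ab: "a \<in> carrier R" "b \<in> carrier R"
    then have "principalideal (Idl {a, b}) R"
      using B unfolding bezout_ring_def by simp
    then obtain d where d: "d \<in> carrier R" "Idl {a, b} = Idl {d}"
      using principalideal.generate by blast
    have "{a, b} \<subseteq> Idl {d}" using genideal_self[of "{a, b}"] ab d by simp
    then obtain x y where xy: "x \<in> carrier R" "a = d \<otimes> x" "y \<in> carrier R" "b = d \<otimes> y"
      using mem_Idl_singleton[OF d(1)] by auto
    \<comment> \<open>The sum of the two principal ideals contains \<open>a\<close> and
      \<open>b\<close>, hence also \<open>d\<close>; this yields the coefficients \<open>u\<close>
      and \<open>v\<close>.\<close>
    have "ideal (Idl {a} <+>\<^bsub>R\<^esub> Idl {b}) R"
      using ab by (intro add_ideals genideal_ideal) auto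
    moreover have sum: "x \<in> Idl {a} <+>\<^bsub>R\<^esub> Idl {b} \<longleftrightarrow>
        (\<exists>u \<in> carrier R. \<exists>v \<in> carrier R. x = a \<otimes> u \<oplus> b \<otimes> v)" for x
    proof -
      have "Idl {c} = (\<lambda>u. c \<otimes> u) ` carrier R" if "c \<in> carrier R" for c
        using mem_Idl_singleton[OF that] by auto
      then show ?thesis using ab unfolding set_add_def' by auto
    qed
    have "a \<in> Idl {a} <+>\<^bsub>R\<^esub> Idl {b}"
      unfolding sum using ab by (intro bexI[of _ \<one>] bexI[of _ \<zero>]) auto
    moreover have "b \<in> Idl {a} <+>\<^bsub>R\<^esub> Idl {b}"
      unfolding sum using ab by (intro bexI[of _ \<zero>] bexI[of _ \<one>]) auto
    ultimately have "d \<in> Idl {a} <+>\<^bsub>R\<^esub> Idl {b}"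
      using genideal_minimal[of "Idl {a} <+>\<^bsub>R\<^esub> Idl {b}" "{a, b}"] d genideal_self'[OF d(1)] by auto
    then obtain u v where "u \<in> carrier R" "v \<in> carrier R" "d = a \<otimes> u \<oplus> b \<otimes> v"
      unfolding sum by blast
    with d xy show "bezout_pair a b"
      by (intro bezout_pairI)
  qed
next
  assume P: "\<forall>a \<in> carrier R. \<forall>b \<in> carrier R. bezout_pair a b"
  have "\<exists>d \<in> carrier R. Idl S = Idl {d}" if "finite S" "S \<subseteq> carrier R" for S
    using that
  proof (induction S rule: finite_induct)
    case empty
    have "Idl {} = Idl {\<zero>}"
      using genideal_minimal[of "Idl {\<zero>}" "{}"] genideal_minimal[of "Idl {}" "{\<zero>}"]
        genideal_ideal[of "{}"] genideal_ideal[of "{\<zero>}"] additive_subgroup.zero_closed ideal.axioms(1)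
      by blast
    then show ?case by blast
  next
    case (insert a S)
    then obtain b where b: "b \<in> carrier R" "Idl S = Idl {b}" by auto
    have a: "a \<in> carrier R" and S: "S \<subseteq> carrier R" using insert.prems by auto
    \<comment> \<open>The generator \<open>b\<close> of the ideal of \<open>S\<close> is merged with
      the new element \<open>a\<close> into \<open>d\<close>.\<close>
    have "bezout_pair a b" using P a b(1) by blast
    then obtain d x y u v
      where c: "d \<in> carrier R" "x \<in> carrier R" "y \<in> carrier R" "u \<in> carrier R" "v \<in> carrier R"
        and eqs: "a = d \<otimes> x" "b = d \<otimes> y" "d = a \<otimes> u \<oplus> b \<otimes> v"
      by (rule bezout_pairE)
    interpret I: ideal "Idl (insert a S)" R by (rule genideal_ideal[OF insert.prems])
    interpret D: ideal "Idl {d}" R using c by (intro genideal_ideal) auto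
    have a_in: "a \<in> Idl (insert a S)" and S_in: "S \<subseteq> Idl (insert a S)"
      using genideal_self[OF insert.prems] by auto
    have "b \<in> Idl (insert a S)"
      using genideal_minimal[OF I.is_ideal S_in] b genideal_self'[OF b(1)] by auto
    then have "Idl {d} \<subseteq> Idl (insert a S)"
      using eqs(3) c a_in by (intro genideal_minimal[OF I.is_ideal]) (auto intro: I.I_r_closed)
    moreover have "a \<in> Idl {d}" "b \<in> Idl {d}"
      using eqs(1,2) c by (auto simp: mem_Idl_singleton)
    then have "S \<subseteq> Idl {d}"
      using genideal_minimal[OF D.is_ideal, of "{b}"] genideal_self[OF S] b(2) by auto
    then have "Idl (insert a S) \<subseteq> Idl {d}"
      using \<open>a \<in> Idl {d}\<close> by (intro genideal_minimal[OF D.is_ideal]) auto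
    ultimately show ?case using c by blast
  qed
  then show "bezout_ring R"
    unfolding bezout_ring_def
    by (intro conjI allI impI cring_axioms principalidealI genideal_ideal)
qed

text \<open>From \<open>(a b) Q = (d 0)\<close> the first column of \<open>Q\<close> expresses
  \<open>d\<close> through \<open>a\<close> and \<open>b\<close>, while
  \<open>(a b) = (d 0) P\<close> with \<open>P\<close> inverse to \<open>Q\<close> shows that
  \<open>d\<close> divides both.\<close>

lemma hermite_imp_bezout:
  assumes "hermite_ring R" shows "bezout_ring R"
  unfolding bezout_ring_iff
proof (intro ballI)
  fix a b assume ab: "a \<in> carrier R" "b \<in> carrier R"
  define M where "M = mat 1 2 (\<lambda>(i, j). if j = 0 then a else b)"
  have M: "M \<in> mats_over R 1 2" unfolding M_def using ab by (intro mats_overI) auto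
  then obtain Q where "nonsingular_mat R 2 Q" and T: "triangular_mat R (mult_mat_over R M Q)"
    using assms unfolding hermite_ring_def by meson
  then obtain P where Q: "Q \<in> mats_over R 2 2" and P: "P \<in> mats_over R 2 2"
    and QP: "mult_mat_over R Q P = one_mat_over R 2"
    unfolding nonsingular_mat_def by blast
  note MQ = mult_mat_over_closed[OF M Q]
  define d where "d = mult_mat_over R M Q $$ (0, 0)"
  have two: "(\<Oplus>j\<in>{..<2::nat}. g j) = g 0 \<oplus> g 1" if "g 0 \<in> carrier R" "g 1 \<in> carrier R" for g
    using that by (intro finsum_two_terms) (auto simp: less_2_cases_iff)
  have zero: "mult_mat_over R M Q $$ (0, 1) = \<zero>"
    using T mats_over_dim[OF MQ] unfolding triangular_mat_def by simp
  have carr: "P $$ (i, j) \<in> carrier R" "Q $$ (i, j) \<in> carrier R" if "i < 2" "j < 2" for i j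
    using that P Q mats_over_entry by blast+
  have d: "d \<in> carrier R"
    unfolding d_def using mats_over_entry[OF MQ] by simp
  have "d = a \<otimes> Q $$ (0, 0) \<oplus> b \<otimes> Q $$ (1, 0)"
    unfolding d_def using ab carr
    by (subst mult_mat_over_entry[OF M Q]) (auto simp: two M_def)
  moreover have "M $$ (0, j) = d \<otimes> P $$ (0, j)" if "j < 2" for j
  proof -
    have "M = mult_mat_over R (mult_mat_over R M Q) P"
      using mult_mat_over_assoc[OF M Q P] QP mult_mat_over_one[OF M] by simp
    then have "M $$ (0, j) = mult_mat_over R (mult_mat_over R M Q) P $$ (0, j)"
      by simp
    also have "\<dots> = d \<otimes> P $$ (0, j)"
      using that carr d zero
      by (subst mult_mat_over_entry[OF MQ P]) (auto simp: two d_def[symmetric])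
    finally show ?thesis .
  qed
  from this[of 0] this[of 1] have "a = d \<otimes> P $$ (0, 0)" "b = d \<otimes> P $$ (0, 1)"
    by (simp_all add: M_def)
  ultimately show "bezout_pair a b"
    using d carr by (intro bezout_pairI[of d]) auto
qed

end

text \<open>The cofactors of a nonzero generator \<open>d\<close> are comaximal because
  \<open>d\<close> cancels from \<open>d (x u + y v) = d\<close>.\<close>

lemma (in domain) bezout_imp_hermite_pair:
  assumes "bezout_pair a b" "a \<in> carrier R" "b \<in> carrier R"
  shows "hermite_pair a b"
proof -
  obtain d x y u v
    where c: "d \<in> carrier R" "x \<in> carrier R" "y \<in> carrier R" "u \<in> carrier R" "v \<in> carrier R"
      and eqs: "a = d \<otimes> x" "b = d \<otimes> y" "d = a \<otimes> u \<oplus> b \<otimes> v"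
    by (rule bezout_pairE[OF assms(1)])
  show ?thesis
  proof (cases "d = \<zero>")
    case True
    \<comment> \<open>Both elements are zero, and \<open>d\<close> cannot be cancelled; the
      comaximal pair \<open>(1, 0)\<close> with common factor \<open>0\<close> is taken
      instead.\<close>
    then show ?thesis
      using eqs(1,2) c by (intro hermite_pairI[of \<one> \<zero> \<zero> \<one> \<zero>]) auto
  next
    case False
    have "d \<otimes> (x \<otimes> u \<oplus> y \<otimes> v) = d \<otimes> x \<otimes> u \<oplus> d \<otimes> y \<otimes> v"
      using c by algebra
    also have "\<dots> = d \<otimes> \<one>" using c by (simp add: eqs[symmetric])
    finally have "x \<otimes> u \<oplus> y \<otimes> v = \<one>"
      using m_lcancel[OF False c(1), of "x \<otimes> u \<oplus> y \<otimes> v" \<one>] c by simp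
    then show ?thesis
      using eqs(1,2) c by (intro hermite_pairI[of x y d u v]) (auto simp: m_comm)
  qed
qed

section \<open>Amalgamations\<close>

lemma carrier_amalgamation: "carrier (amalgamation A B f J) = amalg_set A B f J"
  by (simp add: amalgamation_def)

lemma amalgamation_simps:
  "(a, b) \<oplus>\<^bsub>amalgamation A B f J\<^esub> (c, d) = (a \<oplus>\<^bsub>A\<^esub> c, b \<oplus>\<^bsub>B\<^esub> d)"
  "(a, b) \<otimes>\<^bsub>amalgamation A B f J\<^esub> (c, d) = (a \<otimes>\<^bsub>A\<^esub> c, b \<otimes>\<^bsub>B\<^esub> d)"
  "\<one>\<^bsub>amalgamation A B f J\<^esub> = (\<one>\<^bsub>A\<^esub>, \<one>\<^bsub>B\<^esub>)"
  "\<zero>\<^bsub>amalgamation A B f J\<^esub> = (\<zero>\<^bsub>A\<^esub>, \<zero>\<^bsub>B\<^esub>)"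
  using RDirProd_simps[of A B] by (simp_all add: amalgamation_def)

lemma fst_amalgamation_simps:
  "fst (x \<oplus>\<^bsub>amalgamation A B f J\<^esub> y) = fst x \<oplus>\<^bsub>A\<^esub> fst y"
  "fst (x \<otimes>\<^bsub>amalgamation A B f J\<^esub> y) = fst x \<otimes>\<^bsub>A\<^esub> fst y"
  by (cases x; cases y; simp add: amalgamation_simps)+

lemma snd_amalgamation_simps:
  "snd (x \<oplus>\<^bsub>amalgamation A B f J\<^esub> y) = snd x \<oplus>\<^bsub>B\<^esub> snd y"
  "snd (x \<otimes>\<^bsub>amalgamation A B f J\<^esub> y) = snd x \<otimes>\<^bsub>B\<^esub> snd y"
  by (cases x; cases y; simp add: amalgamation_simps)+

locale domain_amalgamation = A: domain A + B: domain B + J: ideal J B + f: ring_hom_cring A B f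
  for A :: "('a, 'm) ring_scheme" and B :: "('b, 'n) ring_scheme" and f J
begin

abbreviation amalg where "amalg \<equiv> amalgamation A B f J"

sublocale amalg: cring amalg
  by (rule amalgamation_cring[OF A.is_cring B.is_cring f.homh J.is_ideal])

lemma amalg_memE:
  assumes "z \<in> carrier amalg"
  obtains a j where "a \<in> carrier A" "j \<in> J" "j \<in> carrier B" "z = (a, f a \<oplus>\<^bsub>B\<^esub> j)"
  using assms J.Icarr unfolding carrier_amalgamation amalg_set_def by blast

lemma amalg_memI:
  assumes "a \<in> carrier A" "j \<in> J" "b = f a \<oplus>\<^bsub>B\<^esub> j"
  shows "(a, b) \<in> carrier amalg"
  using assms unfolding carrier_amalgamation amalg_set_def by blast

lemma carrier_amalg_subset: "carrier amalg \<subseteq> carrier A \<times> carrier B"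
  by (auto elim!: amalg_memE)

text \<open>The amalgamation becomes the graph of \<open>f\<close>, a copy of
  \<open>A\<close>.\<close>

lemma carrier_amalg_zero_ideal:
  assumes "J = {\<zero>\<^bsub>B\<^esub>}"
  shows "carrier amalg = (\<lambda>a. (a, f a)) ` carrier A"
  unfolding carrier_amalgamation amalg_set_def assms by auto

lemma carrier_amalg_full_ideal:
  assumes "J = carrier B"
  shows "carrier amalg = carrier A \<times> carrier B"
proof
  show "carrier amalg \<subseteq> carrier A \<times> carrier B"
    by (rule carrier_amalg_subset)
  show "carrier A \<times> carrier B \<subseteq> carrier amalg"
  proof clarify
    fix a b assume ab: "a \<in> carrier A" "b \<in> carrier B"
    \<comment> \<open>The element of \<open>J\<close> is \<open>b - f a\<close>, which is
      unrestricted when \<open>J\<close> is all of \<open>B\<close>.\<close>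
    then have "b = f a \<oplus>\<^bsub>B\<^esub> (\<ominus>\<^bsub>B\<^esub> f a \<oplus>\<^bsub>B\<^esub> b)"
      using f.hom_closed[of a] by (simp add: B.r_neg2)
    then show "(a, b) \<in> carrier amalg"
      using ab assms by (intro amalg_memI) auto
  qed
qed

section \<open>Necessity of the conditions on \<open>A\<close>, \<open>B\<close> and
  \<open>J\<close>\<close>

text \<open>The first projection is a surjection onto \<open>A\<close>, with preimages
  \<open>(c, f c)\<close>, and carries the equations of a Bezout pair to \<open>A\<close>.\<close>

lemma bezout_ring_fst:
  assumes "bezout_ring amalg" shows "bezout_ring A"
  unfolding A.bezout_ring_iff
proof (intro ballI)
  fix a b assume ab: "a \<in> carrier A" "b \<in> carrier A"
  have lift: "(c, f c) \<in> carrier amalg" if "c \<in> carrier A" for c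
    using that f.hom_closed[of c] by (intro amalg_memI[OF that J.zero_closed]) simp
  have "amalg.bezout_pair (a, f a) (b, f b)"
    using assms lift ab unfolding amalg.bezout_ring_iff by blast
  then obtain D X Y U V
    where carr: "D \<in> carrier amalg" "X \<in> carrier amalg" "Y \<in> carrier amalg"
      "U \<in> carrier amalg" "V \<in> carrier amalg"
      and eqs: "(a, f a) = D \<otimes>\<^bsub>amalg\<^esub> X" "(b, f b) = D \<otimes>\<^bsub>amalg\<^esub> Y"
      "D = (a, f a) \<otimes>\<^bsub>amalg\<^esub> U \<oplus>\<^bsub>amalg\<^esub> (b, f b) \<otimes>\<^bsub>amalg\<^esub> V"
    by (rule amalg.bezout_pairE)
  have fst: "fst z \<in> carrier A" if "z \<in> carrier amalg" for z
    using that carrier_amalg_subset by auto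
  show "A.bezout_pair a b"
    using arg_cong[OF eqs(1), of fst] arg_cong[OF eqs(2), of fst] arg_cong[OF eqs(3), of fst]
    by (intro A.bezout_pairI[OF carr[THEN fst]])
      (simp_all only: fst_amalgamation_simps fst_conv)
qed

text \<open>For \<open>J = B\<close> the second projection is onto \<open>B\<close> as well;
  elements of \<open>B\<close> are lifted with first component zero.\<close>

lemma bezout_ring_snd:
  assumes "bezout_ring amalg" "J = carrier B" shows "bezout_ring B"
  unfolding B.bezout_ring_iff
proof (intro ballI)
  fix a b assume ab: "a \<in> carrier B" "b \<in> carrier B"
  have "amalg.bezout_pair (\<zero>\<^bsub>A\<^esub>, a) (\<zero>\<^bsub>A\<^esub>, b)"
    using assms ab unfolding amalg.bezout_ring_iff carrier_amalg_full_ideal[OF assms(2)] by simp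
  then obtain D X Y U V
    where carr: "D \<in> carrier amalg" "X \<in> carrier amalg" "Y \<in> carrier amalg"
      "U \<in> carrier amalg" "V \<in> carrier amalg"
      and eqs: "(\<zero>\<^bsub>A\<^esub>, a) = D \<otimes>\<^bsub>amalg\<^esub> X" "(\<zero>\<^bsub>A\<^esub>, b) = D \<otimes>\<^bsub>amalg\<^esub> Y"
      "D = (\<zero>\<^bsub>A\<^esub>, a) \<otimes>\<^bsub>amalg\<^esub> U \<oplus>\<^bsub>amalg\<^esub> (\<zero>\<^bsub>A\<^esub>, b) \<otimes>\<^bsub>amalg\<^esub> V"
    by (rule amalg.bezout_pairE)
  have snd: "snd z \<in> carrier B" if "z \<in> carrier amalg" for z
    using that carrier_amalg_subset by auto
  show "B.bezout_pair a b"
    using arg_cong[OF eqs(1), of snd] arg_cong[OF eqs(2), of snd] arg_cong[OF eqs(3), of snd]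
    by (intro B.bezout_pairI[OF carr[THEN snd]])
      (simp_all only: snd_amalgamation_simps snd_conv)
qed

text \<open>
  The ideal generated by \<open>(a\<^sub>0, 0)\<close> and \<open>(0, j\<^sub>0)\<close>, with \<open>0 \<noteq> a\<^sub>0 \<in> ker f\<close> and \<open>0 \<noteq> j\<^sub>0 \<in> J\<close>, has a
  generator \<open>(d, e)\<close> with \<open>d\<close> and \<open>e\<close> nonzero. Writing \<open>(a\<^sub>0, 0) = (d, e)(x, y)\<close> forces \<open>y = 0\<close>, so
  \<open>f x \<in> J\<close>, whereas \<open>d \<in> A a\<^sub>0\<close> makes \<open>x\<close> a unit.
\<close>

lemma bezout_ring_imp_full_ideal:
  assumes "bezout_ring amalg" and J: "J \<noteq> {\<zero>\<^bsub>B\<^esub>}" and f: "\<not> inj_on f (carrier A)"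
  shows "J = carrier B"
proof -
  obtain j0 where j0: "j0 \<in> J" "j0 \<noteq> \<zero>\<^bsub>B\<^esub>" "j0 \<in> carrier B"
    using J J.zero_closed J.Icarr by blast
  obtain a b where "a \<in> carrier A" "b \<in> carrier A" "f a = f b" "a \<noteq> b"
    using f unfolding inj_on_def by blast
  \<comment> \<open>The difference of two elements with the same image is a nonzero element of the
    kernel.\<close>
  then have "a \<ominus>\<^bsub>A\<^esub> b \<in> carrier A" "a \<ominus>\<^bsub>A\<^esub> b \<noteq> \<zero>\<^bsub>A\<^esub>" "f (a \<ominus>\<^bsub>A\<^esub> b) = \<zero>\<^bsub>B\<^esub>"
    using f.hom_closed[of b] by (simp_all add: A.minus_eq B.r_neg A.r_right_minus_eq[unfolded A.minus_eq])
  then obtain a0 where a0: "a0 \<in> carrier A" "a0 \<noteq> \<zero>\<^bsub>A\<^esub>" "f a0 = \<zero>\<^bsub>B\<^esub>"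
    by blast
  have "(a0, \<zero>\<^bsub>B\<^esub>) \<in> carrier amalg" "(\<zero>\<^bsub>A\<^esub>, j0) \<in> carrier amalg"
    using a0 j0 amalg_memI[of a0 "\<zero>\<^bsub>B\<^esub>"] amalg_memI[of "\<zero>\<^bsub>A\<^esub>" j0] by simp_all
  then have "amalg.bezout_pair (a0, \<zero>\<^bsub>B\<^esub>) (\<zero>\<^bsub>A\<^esub>, j0)"
    using assms(1) unfolding amalg.bezout_ring_iff by blast
  then obtain D X Y U V
    where carr: "D \<in> carrier amalg" "X \<in> carrier amalg" "Y \<in> carrier amalg"
      "U \<in> carrier amalg" "V \<in> carrier amalg"
      and eqs: "(a0, \<zero>\<^bsub>B\<^esub>) = D \<otimes>\<^bsub>amalg\<^esub> X" "(\<zero>\<^bsub>A\<^esub>, j0) = D \<otimes>\<^bsub>amalg\<^esub> Y"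
      "D = (a0, \<zero>\<^bsub>B\<^esub>) \<otimes>\<^bsub>amalg\<^esub> U \<oplus>\<^bsub>amalg\<^esub> (\<zero>\<^bsub>A\<^esub>, j0) \<otimes>\<^bsub>amalg\<^esub> V"
    by (rule amalg.bezout_pairE)
  obtain d e where D: "D = (d, e)" "d \<in> carrier A" "e \<in> carrier B"
    using carr(1) carrier_amalg_subset by blast
  \<comment> \<open>Only \<open>X\<close> is split by the form of the amalgamation: its part
    \<open>k\<close> in \<open>J\<close> is what ties \<open>f x\<close> to
    \<open>J\<close>.\<close>
  obtain x k where X: "X = (x, f x \<oplus>\<^bsub>B\<^esub> k)" "x \<in> carrier A" "k \<in> J" "k \<in> carrier B"
    using carr(2) by (rule amalg_memE)
  obtain y y' where Y: "Y = (y, y')" "y \<in> carrier A" "y' \<in> carrier B"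
    using carr(3) carrier_amalg_subset by blast
  obtain u u' where U: "U = (u, u')" "u \<in> carrier A" "u' \<in> carrier B"
    using carr(4) carrier_amalg_subset by blast
  obtain v v' where V: "V = (v, v')" "v \<in> carrier A" "v' \<in> carrier B"
    using carr(5) carrier_amalg_subset by blast
  have a0_eq: "a0 = d \<otimes>\<^bsub>A\<^esub> x" and zero: "\<zero>\<^bsub>B\<^esub> = e \<otimes>\<^bsub>B\<^esub> (f x \<oplus>\<^bsub>B\<^esub> k)"
    using eqs(1) D X by (auto simp: amalgamation_simps)
  have "j0 = e \<otimes>\<^bsub>B\<^esub> y'"
    using eqs(2) D Y by (auto simp: amalgamation_simps)
  then have "e \<noteq> \<zero>\<^bsub>B\<^esub>"
    using j0 Y by auto
  then have k: "f x \<oplus>\<^bsub>B\<^esub> k = \<zero>\<^bsub>B\<^esub>"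
    using zero B.integral[of e "f x \<oplus>\<^bsub>B\<^esub> k"] D X f.hom_closed[of x] by simp
  \<comment> \<open>The first component of \<open>(0, j0)\<close> is zero, so only \<open>a0\<close>
    contributes to \<open>d\<close>. With \<open>a0 = d x\<close> this gives
    \<open>a0 = a0 u x\<close>, and \<open>a0\<close> cancels in the domain
    \<open>A\<close>.\<close>
  have "d = a0 \<otimes>\<^bsub>A\<^esub> u"
    using eqs(3) D U V a0 by (auto simp: amalgamation_simps)
  then have "a0 \<otimes>\<^bsub>A\<^esub> (u \<otimes>\<^bsub>A\<^esub> x) = a0 \<otimes>\<^bsub>A\<^esub> \<one>\<^bsub>A\<^esub>"
    using a0_eq a0 U X by (simp add: A.m_assoc[symmetric])
  then have "u \<otimes>\<^bsub>A\<^esub> x = \<one>\<^bsub>A\<^esub>"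
    using A.m_lcancel[OF a0(2,1), of "u \<otimes>\<^bsub>A\<^esub> x" "\<one>\<^bsub>A\<^esub>"] U X by simp
  then have "f u \<otimes>\<^bsub>B\<^esub> f x = \<one>\<^bsub>B\<^esub>"
    using U X by (metis f.hom_mult f.hom_one)
  moreover have "f x = \<ominus>\<^bsub>B\<^esub> k"
    using k X B.minus_equality by (metis f.hom_closed)
  then have "f x \<in> J"
    using X J.a_inv_closed by simp
  \<comment> \<open>The ideal \<open>J\<close> contains \<open>f x = - k\<close>, and
    \<open>f u\<close> is its inverse in \<open>B\<close>.\<close>
  ultimately have "\<one>\<^bsub>B\<^esub> \<in> J"
    using J.I_l_closed[of "f x" "f u"] U f.hom_closed by simp
  then show ?thesis
    by (rule J.one_imp_carrier)
qed

section \<open>Sufficiency: the two cases for \<open>J\<close>\<close>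

text \<open>Each witness \<open>c\<close> of Kaplansky's condition in \<open>A\<close> is replaced
  by \<open>(c, f c)\<close>; the second components satisfy the same equations because
  \<open>f\<close> is a homomorphism.\<close>

lemma hermite_ring_zero_ideal:
  assumes "J = {\<zero>\<^bsub>B\<^esub>}" "bezout_ring A" shows "hermite_ring amalg"
proof (rule amalg.hermite_ringI)
  note carr = carrier_amalg_zero_ideal[OF assms(1)]
  fix w z assume "w \<in> carrier amalg" "z \<in> carrier amalg"
  then obtain a b where ab: "a \<in> carrier A" "b \<in> carrier A" "w = (a, f a)" "z = (b, f b)"
    unfolding carr by blast
  then have "A.hermite_pair a b"
    using assms(2) A.bezout_imp_hermite_pair unfolding A.bezout_ring_iff by blast
  then obtain a' b' d s t
    where c: "a' \<in> carrier A" "b' \<in> carrier A" "d \<in> carrier A" "s \<in> carrier A" "t \<in> carrier A"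
      and eqs: "a = a' \<otimes>\<^bsub>A\<^esub> d" "b = b' \<otimes>\<^bsub>A\<^esub> d" "a' \<otimes>\<^bsub>A\<^esub> s \<oplus>\<^bsub>A\<^esub> b' \<otimes>\<^bsub>A\<^esub> t = \<one>\<^bsub>A\<^esub>"
    by (rule A.hermite_pairE)
  have "f a' \<otimes>\<^bsub>B\<^esub> f s \<oplus>\<^bsub>B\<^esub> f b' \<otimes>\<^bsub>B\<^esub> f t = f (a' \<otimes>\<^bsub>A\<^esub> s \<oplus>\<^bsub>A\<^esub> b' \<otimes>\<^bsub>A\<^esub> t)"
    using c by simp
  then have "f a' \<otimes>\<^bsub>B\<^esub> f s \<oplus>\<^bsub>B\<^esub> f b' \<otimes>\<^bsub>B\<^esub> f t = \<one>\<^bsub>B\<^esub>"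
    unfolding eqs(3) by simp
  then show "amalg.hermite_pair w z"
    using c eqs ab
    by (intro amalg.hermite_pairI[of "(a', f a')" "(b', f b')" "(d, f d)" "(s, f s)" "(t, f t)"])
      (auto simp: carr amalgamation_simps)
qed

text \<open>The product \<open>A \<times> B\<close> has zero divisors, so cancellation takes place
  in each factor and the witnesses are then paired.\<close>

lemma hermite_ring_full_ideal:
  assumes "J = carrier B" "bezout_ring A" "bezout_ring B" shows "hermite_ring amalg"
proof (rule amalg.hermite_ringI)
  note carr = carrier_amalg_full_ideal[OF assms(1)]
  fix w z assume "w \<in> carrier amalg" "z \<in> carrier amalg"
  then obtain a a2 b b2
    where ab: "a \<in> carrier A" "b \<in> carrier A" "a2 \<in> carrier B" "b2 \<in> carrier B"
      and wz: "w = (a, a2)" "z = (b, b2)"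
    unfolding carr by blast
  have "A.hermite_pair a b" "B.hermite_pair a2 b2"
    using ab assms A.bezout_imp_hermite_pair B.bezout_imp_hermite_pair
    unfolding A.bezout_ring_iff B.bezout_ring_iff by blast+
  then show "amalg.hermite_pair w z"
  proof (elim A.hermite_pairE B.hermite_pairE)
    fix p q d s t p' q' d' s' t'
    assume "p \<in> carrier A" "q \<in> carrier A" "d \<in> carrier A" "s \<in> carrier A" "t \<in> carrier A"
      "a = p \<otimes>\<^bsub>A\<^esub> d" "b = q \<otimes>\<^bsub>A\<^esub> d" "p \<otimes>\<^bsub>A\<^esub> s \<oplus>\<^bsub>A\<^esub> q \<otimes>\<^bsub>A\<^esub> t = \<one>\<^bsub>A\<^esub>"
      "p' \<in> carrier B" "q' \<in> carrier B" "d' \<in> carrier B" "s' \<in> carrier B" "t' \<in> carrier B"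
      "a2 = p' \<otimes>\<^bsub>B\<^esub> d'" "b2 = q' \<otimes>\<^bsub>B\<^esub> d'" "p' \<otimes>\<^bsub>B\<^esub> s' \<oplus>\<^bsub>B\<^esub> q' \<otimes>\<^bsub>B\<^esub> t' = \<one>\<^bsub>B\<^esub>"
    then show ?thesis
      using wz
      by (intro amalg.hermite_pairI[of "(p, p')" "(q, q')" "(d, d')" "(s, s')" "(t, t')"])
        (simp_all add: carr amalgamation_simps)
  qed
qed

end

theorem theorem2p13:
  fixes A :: "('a, 'm) ring_scheme" and B :: "('b, 'n) ring_scheme"
    and f :: "'a \<Rightarrow> 'b" and J :: "'b set"
  assumes "domain A" and "domain B"
    and "ideal J B"
    and "f \<in> ring_hom A B" and "\<not> inj_on f (carrier A)"
  shows "(hermite_ring (amalgamation A B f J) \<longleftrightarrow> bezout_ring (amalgamation A B f J))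
    \<and> (bezout_ring (amalgamation A B f J) \<longleftrightarrow>
        (J = carrier B \<and> bezout_ring A \<and> bezout_ring B) \<or>
        (J = {\<zero>\<^bsub>B\<^esub>} \<and> bezout_ring A))"
proof -
  interpret domain_amalgamation A B f J
    using assms(1-4)
    by (simp add: domain_amalgamation_def ring_hom_cring_def ring_hom_cring_axioms_def domain.axioms(1))
  \<comment> \<open>The implications close a cycle: Hermite, Bezout, the conditions on
    \<open>J\<close>, Hermite. For the middle one, \<open>J\<close> is zero or else all of
    \<open>B\<close>, where both projections apply.\<close>
  show ?thesis
    using amalg.hermite_imp_bezout bezout_ring_fst bezout_ring_snd
      bezout_ring_imp_full_ideal[OF _ _ assms(5)] hermite_ring_zero_ideal hermite_ring_full_ideal
    by blast
qed

end
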